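(* Let $(X,|\cdot|)$ be a real normed vector space whose norm $|\cdot|$ does not come from an inner product, regarded as a length space with the metric $\mathrm{d}(x,y)=|y-x|$. Then $(X,\mathrm{d})$ has neither an upper nor a lower sectional curvature bound; that is, there is no $K\in\mathbb{R}$ such that $(X,\mathrm{d})$ has sectional curvature bounded below by $K$, and there is no $K\in\mathbb{R}$ such that $(X,\mathrm{d})$ has sectional curvature bounded above by $K$.
   Context: For $K\in\mathbb{R}$ let $(\mathcal{S}^+_K,\bar{\mathrm{d}})$ be the complete simply connected two-dimensional Riemannian model space of constant sectional curvature $K$ (scaled sphere for $K>0$, Euclidean plane for $K=0$, scaled hyperbolic plane for $K<0$) with its distance function. A triangle $abc$ in a metric space $(X,\mathrm{d})$ consists of three vertices $a,b,c$ together with a choice of distance realizers (shortest paths) $ab$, $bc$, $ac$ as edges. A comparison triangle $\bar a\bar b\bar c\subset\mathcal{S}^+_K$ is a triangle with the same side lengths (it exists, e.g., for all sufficiently small triangles). For a point $M$ on the edge $bc$, the comparison point $\bar M$ on $\bar b\bar c$ is the point with $\bar{\mathrm{d}}(\bar b,\bar M)=\mathrm{d}(b,M)$ and $\bar{\mathrm{d}}(\bar M,\bar c)=\mathrm{d}(M,c)$. A length space $(X,\mathrm{d})$ (with distance realizers between points) has sectional curvature bounded below (respectively above) by $K$ if every point $p\in X$ has a neighborhood $U$ such that for every triangle $abc\subset U$ admitting a comparison triangle $\bar a\bar b\bar c\subset\mathcal{S}^+_K$ (for $K>0$: of perimeter less than $2\pi/\sqrt{K}$) and every point $M$ on the edge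 $bc$ one has $\mathrm{d}(a,M)\ge\bar{\mathrm{d}}(\bar a,\bar M)$ (respectively $\mathrm{d}(a,M)\le\bar{\mathrm{d}}(\bar a,\bar M)$). *)

theory Defs
  imports "HOL-Analysis.Analysis"
begin

section \<open>Norms that come from an inner product\<close>

text \<open>The conditions are those of the class \<^class>\<open>real_inner\<close>, for an inner product that is not
  part of the type.\<close>

definition inner_product :: "('a::real_vector \<Rightarrow> 'a \<Rightarrow> real) \<Rightarrow> bool" where
  "inner_product ip \<longleftrightarrow>
     bilinear ip \<and> (\<forall>x y. ip x y = ip y x) \<and> (\<forall>x. 0 \<le> ip x x) \<and> (\<forall>x. ip x x = 0 \<longrightarrow> x = 0)"

definition norm_from_inner_product :: "'a::real_normed_vector itself \<Rightarrow> bool" where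
  "norm_from_inner_product _ \<longleftrightarrow>
     (\<exists>ip :: 'a \<Rightarrow> 'a \<Rightarrow> real. inner_product ip \<and> (\<forall>x. norm x = sqrt (ip x x)))"


section \<open>Distance realizers and triangles\<close>

text \<open>The distance function is a parameter, so that the same notions serve for a metric space
  (with \<^const>\<open>dist\<close>) and for the model spaces below, whose distance is not the one of the ambient
  type. Continuity always refers to the topology of the type; on each model space the intrinsic
  distance induces the subspace topology, so this is the right notion there as well.\<close>

definition curve_length :: "('a \<Rightarrow> 'a \<Rightarrow> real) \<Rightarrow> (real \<Rightarrow> 'a) \<Rightarrow> ereal" where
  "curve_length d g =
     (SUP ts \<in> {ts. sorted ts \<and> set ts \<subseteq> {0..1}}.
        ereal (\<Sum>i < length ts - 1. d (g (ts ! i)) (g (ts ! Suc i))))"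

definition distance_realizer ::
  "'a::topological_space set \<Rightarrow> ('a \<Rightarrow> 'a \<Rightarrow> real) \<Rightarrow> 'a \<Rightarrow> 'a \<Rightarrow> (real \<Rightarrow> 'a) \<Rightarrow> bool" where
  "distance_realizer S d x y g \<longleftrightarrow>
     path g \<and> path_image g \<subseteq> S \<and> pathstart g = x \<and> pathfinish g = y \<and>
     curve_length d g = ereal (d x y)"

definition triangle ::
  "'a::topological_space set \<Rightarrow> ('a \<Rightarrow> 'a \<Rightarrow> real) \<Rightarrow>
     'a \<Rightarrow> 'a \<Rightarrow> 'a \<Rightarrow> (real \<Rightarrow> 'a) \<Rightarrow> (real \<Rightarrow> 'a) \<Rightarrow> (real \<Rightarrow> 'a) \<Rightarrow> bool" where
  "triangle S d a b c ab bc ac \<longleftrightarrow>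
     distance_realizer S d a b ab \<and> distance_realizer S d b c bc \<and> distance_realizer S d a c ac"


section \<open>The model spaces of constant curvature\<close>

text \<open>For \<open>K > 0\<close> this is the sphere of radius \<open>1 / sqrt K\<close>, for \<open>K = 0\<close> the plane, and for \<open>K < 0\<close>
  the upper sheet of the hyperboloid \<open>\<langle>x, x\<rangle> = 1 / K\<close> in Minkowski space. The distance functions
  are those of the induced Riemannian metrics: on the sphere
  \<open>d x y = angle / sqrt K\<close> with \<open>cos angle = K * (x \<bullet> y)\<close>, and on the hyperboloid
  \<open>d x y = r / sqrt (- K)\<close> with \<open>cosh r = K * \<langle>x, y\<rangle>\<close>.\<close>

definition minkowski :: "real^3 \<Rightarrow> real^3 \<Rightarrow> real" where
  "minkowski x y = x$1 * y$1 + x$2 * y$2 - x$3 * y$3"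

definition model_space :: "real \<Rightarrow> (real^3) set" where
  "model_space K =
     (if K > 0 then sphere 0 (1 / sqrt K)
      else if K = 0 then {x. x$3 = 0}
      else {x. minkowski x x = 1 / K \<and> x$3 > 0})"

definition model_dist :: "real \<Rightarrow> real^3 \<Rightarrow> real^3 \<Rightarrow> real" where
  "model_dist K x y =
     (if K > 0 then arccos (K * (x \<bullet> y)) / sqrt K
      else if K = 0 then dist x y
      else arcosh (K * minkowski x y) / sqrt (- K))"


section \<open>Curvature bounds by triangle comparison\<close>

text \<open>Primed letters denote the comparison configuration. A comparison triangle is unique up to
  isometries of the model space (for \<open>K > 0\<close> because of the bound on the perimeter), and so
  quantifying over all of them amounts to fixing one.\<close>

definition comparison_triangle ::
  "real \<Rightarrow> 'a::metric_space \<Rightarrow> 'a \<Rightarrow> 'a \<Rightarrow> real^3 \<Rightarrow> real^3 \<Rightarrow> real^3 \<Rightarrow>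
     (real \<Rightarrow> real^3) \<Rightarrow> (real \<Rightarrow> real^3) \<Rightarrow> (real \<Rightarrow> real^3) \<Rightarrow> bool" where
  "comparison_triangle K a b c a' b' c' ab' bc' ac' \<longleftrightarrow>
     triangle (model_space K) (model_dist K) a' b' c' ab' bc' ac' \<and>
     model_dist K a' b' = dist a b \<and> model_dist K b' c' = dist b c \<and> model_dist K a' c' = dist a c \<and>
     (K > 0 \<longrightarrow> dist a b + dist b c + dist a c < 2 * pi / sqrt K)"

definition triangle_comparison ::
  "(real \<Rightarrow> real \<Rightarrow> bool) \<Rightarrow> real \<Rightarrow> 'a::metric_space set \<Rightarrow> bool" where
  "triangle_comparison R K U \<longleftrightarrow>
     (\<forall>a b c ab bc ac a' b' c' ab' bc' ac'.
        triangle U dist a b c ab bc ac \<longrightarrow>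
        comparison_triangle K a b c a' b' c' ab' bc' ac' \<longrightarrow>
        (\<forall>M \<in> path_image bc. \<forall>M' \<in> path_image bc'.
           model_dist K b' M' = dist b M \<longrightarrow> model_dist K M' c' = dist M c \<longrightarrow>
           R (dist a M) (model_dist K a' M')))"

text \<open>The curvature bounds are meant for spaces in which any two points are joined by a distance
  realizer. Normed spaces are of this kind, as shown at the end.\<close>

definition sectional_curvature_bounded_below :: "'a::metric_space itself \<Rightarrow> real \<Rightarrow> bool" where
  "sectional_curvature_bounded_below _ K \<longleftrightarrow>
     (\<forall>p :: 'a. \<exists>U. p \<in> interior U \<and> triangle_comparison (\<ge>) K U)"

definition sectional_curvature_bounded_above :: "'a::metric_space itself \<Rightarrow> real \<Rightarrow> bool" where
  "sectional_curvature_bounded_above _ K \<longleftrightarrow>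
     (\<forall>p :: 'a. \<exists>U. p \<in> interior U \<and> triangle_comparison (\<le>) K U)"

lemma sum_telescope_sorted:
  fixes ts :: "real list"
  assumes "sorted ts" "ts \<noteq> []"
  shows "(\<Sum>i < length ts - 1. \<bar>ts ! i - ts ! Suc i\<bar>) = last ts - hd ts"
proof -
  have "(\<Sum>i < length ts - 1. \<bar>ts ! i - ts ! Suc i\<bar>) = (\<Sum>i < length ts - 1. ts ! Suc i - ts ! i)"
  proof (rule sum.cong)
    fix i assume "i \<in> {..<length ts - 1}"
    then have "ts ! i \<le> ts ! Suc i" using sorted_nth_mono[OF assms(1), of i "Suc i"] by simp
    then show "\<bar>ts ! i - ts ! Suc i\<bar> = ts ! Suc i - ts ! i" by linarith
  qed simp
  also have "\<dots> = ts ! (length ts - 1) - ts ! 0"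
    by (rule sum_lessThan_telescope)
  finally show ?thesis
    using assms(2) by (simp add: last_conv_nth hd_conv_nth)
qed

lemma linepath_distance_realizer:
  fixes x y :: "'a::real_normed_vector"
  shows "distance_realizer UNIV dist x y (linepath x y)"
proof -
  have d: "dist (linepath x y s) (linepath x y t) = \<bar>s - t\<bar> * dist x y" for s t
  proof -
    have "linepath x y s - linepath x y t = (t - s) *\<^sub>R (x - y)"
      by (simp add: linepath_def algebra_simps)
    then show ?thesis by (simp only: dist_norm norm_scaleR abs_minus_commute)
  qed
  have le: "(\<Sum>i < length ts - 1. \<bar>ts ! i - ts ! Suc i\<bar>) \<le> 1"
    if "sorted ts" "set ts \<subseteq> {0..1}" for ts :: "real list"
  proof (cases "ts = []")
    case False
    then have "last ts \<in> {0..1}" "hd ts \<in> {0..1}"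
      using that(2) last_in_set[OF False] hd_in_set[OF False] by (blast, blast)
    then have "last ts \<le> 1" "0 \<le> hd ts" by simp_all
    then show ?thesis using sum_telescope_sorted[OF that(1) False] by simp
  qed simp
  have "curve_length dist (linepath x y) = ereal (dist x y)"
    unfolding curve_length_def d sum_distrib_right[symmetric]
  proof (rule antisym)
    show "(SUP ts\<in>{ts. sorted ts \<and> set ts \<subseteq> {0..1}}.
        ereal ((\<Sum>i<length ts - 1. \<bar>ts ! i - ts ! Suc i\<bar>) * dist x y)) \<le> ereal (dist x y)"
    proof (rule SUP_least)
      fix ts :: "real list" assume "ts \<in> {ts. sorted ts \<and> set ts \<subseteq> {0..1}}"
      then have "(\<Sum>i<length ts - 1. \<bar>ts ! i - ts ! Suc i\<bar>) \<le> 1" using le by blast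
      from mult_right_mono[OF this zero_le_dist]
      show "ereal ((\<Sum>i<length ts - 1. \<bar>ts ! i - ts ! Suc i\<bar>) * dist x y) \<le> ereal (dist x y)" by simp
    qed
    show "ereal (dist x y) \<le> (SUP ts\<in>{ts. sorted ts \<and> set ts \<subseteq> {0..1}}.
        ereal ((\<Sum>i<length ts - 1. \<bar>ts ! i - ts ! Suc i\<bar>) * dist x y))"
      by (rule SUP_upper2[of "[0, 1]"]) auto
  qed
  then show ?thesis by (simp add: distance_realizer_def)
qed

end

theory Submission
  imports Defs
begin

text \<open>
  The reason is that curvature is invisible at small scales, whereas a norm looks the same at all
  scales. Take vectors \<open>x\<close> and \<open>y\<close> and shrink the triangle with vertices \<open>0\<close>, \<open>x\<close>, \<open>y\<close> by a factor
  \<open>t\<close>. A curvature bound by \<open>K\<close> compares its median from \<open>0\<close>, of length \<open>t * norm (x + y) / 2\<close>, with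
  the median of a small triangle in the model space. As \<open>t\<close> tends to \<open>0\<close>, the length of the latter,
  divided by \<open>t\<close>, tends to the Euclidean value given by the theorem of Apollonius. The limit of the
  comparison is therefore the parallelogram law with an inequality sign, whose direction depends on the
  kind of bound and not on \<open>x\<close> and \<open>y\<close>. Applying this inequality to \<open>x + y\<close> and \<open>x - y\<close> reverses it,
  so that the parallelogram law holds (\<open>parallelogram_law_of_inequality\<close>), and by the theorem
  of Jordan and von Neumann (\<open>jordan_von_neumann\<close>) the norm comes from an inner product.

  The positive, zero and negative curvatures are treated together. In terms of the modified distance
  \<open>md K z\<close>, which is \<open>z\<^sup>2 / 2\<close> for \<open>K = 0\<close> and \<open>(1 - cs K z) / K\<close> otherwise, the sides \<open>p\<close>, \<open>q\<close>, the base
  \<open>r\<close> and the median \<open>m\<close> of a triangle in any of the model spaces satisfy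
  \<open>md K p + md K q = md K (m + r / 2) + md K (m - r / 2)\<close>, the theorem of Apollonius for all \<open>K\<close>.
  Since \<open>md K\<close> increases with the distance and \<open>md K (t * z)\<close> is asymptotic to \<open>(t * z)\<^sup>2 / 2\<close>, the
  limit can be taken without solving for \<open>m\<close>. What remains is to provide the comparison
  triangles together with their sides as distance realizers (\<open>median_comparison\<close>).
\<close>

section \<open>Norms satisfying the parallelogram law\<close>

text \<open>The function has period \<open>1\<close>, so it is bounded on the whole line. As \<open>g (n * s) = n * g s\<close>,
  a nonzero value would have unbounded multiples among the values.\<close>

lemma additive_bounded_imp_zero:
  fixes g :: "real \<Rightarrow> real"
  assumes add: "\<And>s t. g (s + t) = g s + g t"
    and bnd: "\<And>s. 0 \<le> s \<Longrightarrow> s \<le> 1 \<Longrightarrow> \<bar>g s\<bar> \<le> C"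
    and one: "g 1 = 0"
  shows "g s = 0"
proof -
  have zero: "g 0 = 0"
    using add[of 0 0] by simp
  have minus: "g (- s) = - g s" for s
    using add[of s "- s"] zero by simp
  have nat: "g (real n * s) = real n * g s" for n s
    by (induction n) (simp_all add: zero add algebra_simps)
  have int: "g (of_int k) = 0" for k
  proof (cases k)
    case (nonneg n)
    then show ?thesis using nat[of n 1] one by simp
  next
    case (neg n)
    then show ?thesis using nat[of "Suc n" 1] one minus[of "real (Suc n)"] by simp
  qed
  have "\<bar>g s\<bar> \<le> C" for s
  proof -
    have "g s = g (frac s)"
      using add[of "frac s" "of_int \<lfloor>s\<rfloor>"] int by (simp add: frac_def)
    moreover have "\<bar>g (frac s)\<bar> \<le> C"
      using bnd[of "frac s"] frac_ge_0[of s] frac_lt_1[of s] by simp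
    ultimately show ?thesis by simp
  qed
  then have multiples: "real n * \<bar>g s\<bar> \<le> C" for n
    using nat[of n s] by (metis abs_mult abs_of_nat)
  show ?thesis
  proof (rule ccontr)
    assume "g s \<noteq> 0"
    then obtain n where "C < real n * \<bar>g s\<bar>"
      using reals_Archimedean3[of "\<bar>g s\<bar>"] by auto
    then show False using multiples[of n] by simp
  qed
qed

text \<open>Passing from \<open>x\<close>, \<open>y\<close> to \<open>x + y\<close>, \<open>x - y\<close> exchanges the two sides up to a factor of \<open>2\<close>, so either
  inequality implies the reverse one.\<close>

lemma parallelogram_law_of_inequality:
  fixes x y :: "'a::real_normed_vector"
  assumes "\<And>x y :: 'a. R ((norm (x + y))\<^sup>2 + (norm (x - y))\<^sup>2) (2 * (norm x)\<^sup>2 + 2 * (norm y)\<^sup>2)"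
    and "R = (\<le>) \<or> R = (\<ge>)"
  shows "(norm (x + y))\<^sup>2 + (norm (x - y))\<^sup>2 = 2 * (norm x)\<^sup>2 + 2 * (norm y)\<^sup>2"
proof -
  have "norm (x + y + (x - y)) = 2 * norm x" "norm (x + y - (x - y)) = 2 * norm y"
    using norm_scaleR[of 2 x] norm_scaleR[of 2 y] by (simp_all add: scaleR_2)
  then have "(norm (x + y + (x - y)))\<^sup>2 + (norm (x + y - (x - y)))\<^sup>2 = 4 * (norm x)\<^sup>2 + 4 * (norm y)\<^sup>2"
    by (simp add: power_mult_distrib)
  then show ?thesis
    using assms(1)[of x y] assms(1)[of "x + y" "x - y"] assms(2) by auto
qed

text \<open>The polarization formula is the only candidate for the inner product. The parallelogram law makes it
  additive; homogeneity follows by applying \<open>additive_bounded_imp_zero\<close> to the deviation from it, a function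
  of the scalar that is bounded on \<open>{0..1}\<close> since the norm is.\<close>

lemma jordan_von_neumann:
  assumes par: "\<And>x y :: 'a::real_normed_vector.
    (norm (x + y))\<^sup>2 + (norm (x - y))\<^sup>2 = 2 * (norm x)\<^sup>2 + 2 * (norm y)\<^sup>2"
  shows "norm_from_inner_product TYPE('a)"
proof -
  define ip where "ip x y = ((norm (x + y))\<^sup>2 - (norm (x - y))\<^sup>2) / 4" for x y :: 'a
  have comm: "ip x y = ip y x" for x y
    by (simp add: ip_def add.commute norm_minus_commute)
  have self: "ip x x = (norm x)\<^sup>2" for x
  proof -
    have "norm (x + x) = 2 * norm x"
      by (metis norm_scaleR scaleR_2 abs_numeral)
    then show ?thesis by (simp add: ip_def power2_eq_square)
  qed
  have zero: "ip 0 z = 0" for z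
    by (simp add: ip_def)
  have half: "ip (x + y) z + ip (x - y) z = 2 * ip x z" for x y z
  proof -
    have "(norm (x + y + z))\<^sup>2 + (norm (x - y + z))\<^sup>2 = 2 * (norm (x + z))\<^sup>2 + 2 * (norm y)\<^sup>2"
      using par[of "x + z" y] by (simp add: algebra_simps)
    moreover have "(norm (x + y - z))\<^sup>2 + (norm (x - y - z))\<^sup>2 = 2 * (norm (x - z))\<^sup>2 + 2 * (norm y)\<^sup>2"
      using par[of "x - z" y] by (simp add: algebra_simps)
    ultimately show ?thesis unfolding ip_def by argo
  qed
  have double: "ip (2 *\<^sub>R x) z = 2 * ip x z" for x z
    using half[of x x z] zero by (simp add: scaleR_2)
  \<comment> \<open>The identity \<open>half\<close> for half the sum and half the difference of \<open>u\<close> and \<open>v\<close>.\<close>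
  have add: "ip (u + v) z = ip u z + ip v z" for u v z
  proof -
    have "(1/2) *\<^sub>R (u + v) + (1/2) *\<^sub>R (u - v) = u"
      by (simp flip: scaleR_add_right scaleR_2)
    moreover have "(1/2) *\<^sub>R (u + v) - (1/2) *\<^sub>R (u - v) = v"
      by (simp flip: scaleR_diff_right scaleR_2)
    ultimately show ?thesis
      using half[of "(1/2) *\<^sub>R (u + v)" "(1/2) *\<^sub>R (u - v)" z] double[of "(1/2) *\<^sub>R (u + v)" z] by simp
  qed
  have scale: "ip (s *\<^sub>R x) y = s * ip x y" for s x y
  proof -
    define g where "g s = ip (s *\<^sub>R x) y - s * ip x y" for s
    have "g s = 0"
    proof (rule additive_bounded_imp_zero[where g = g])
      show "g (s + t) = g s + g t" for s t
        by (simp add: g_def scaleR_add_left add algebra_simps)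
      show "g 1 = 0"
        by (simp add: g_def)
      show "\<bar>g s\<bar> \<le> (norm x + norm y)\<^sup>2 + \<bar>ip x y\<bar>" if "0 \<le> s" "s \<le> 1" for s
      proof -
        have sx: "norm (s *\<^sub>R x) \<le> norm x"
          using that by (simp add: mult_left_le_one_le)
        have "(norm (s *\<^sub>R x + y))\<^sup>2 \<le> (norm x + norm y)\<^sup>2"
          using norm_triangle_ineq[of "s *\<^sub>R x" y] sx by (intro power_mono) auto
        moreover have "(norm (s *\<^sub>R x - y))\<^sup>2 \<le> (norm x + norm y)\<^sup>2"
          using norm_triangle_ineq4[of "s *\<^sub>R x" y] sx by (intro power_mono) auto
        moreover have "0 \<le> (norm (s *\<^sub>R x + y))\<^sup>2" "0 \<le> (norm (s *\<^sub>R x - y))\<^sup>2"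
          by simp_all
        ultimately have "\<bar>ip (s *\<^sub>R x) y\<bar> \<le> (norm x + norm y)\<^sup>2"
          unfolding ip_def by (simp only: abs_le_iff) argo
        moreover have "\<bar>s * ip x y\<bar> \<le> \<bar>ip x y\<bar>"
          using that by (simp add: abs_mult mult_left_le_one_le)
        ultimately show ?thesis unfolding g_def by linarith
      qed
    qed
    then show ?thesis by (simp add: g_def)
  qed
  have "bilinear ip"
    unfolding bilinear_def
    by (auto intro!: linearI simp: comm[of _ "_ + _"] comm[of _ "_ *\<^sub>R _"] add scale)
      (simp_all add: comm)
  then have "inner_product ip"
    unfolding inner_product_def using comm by (auto simp: self)
  moreover have "norm x = sqrt (ip x x)" for x
    by (simp add: self)
  ultimately show ?thesis
    unfolding norm_from_inner_product_def by blast
qed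


section \<open>Generalized trigonometric functions\<close>

text \<open>The generalized cosine and sine: the solutions of \<open>f'' + K * f = 0\<close> with the initial values of
  cosine and sine. With them most formulas of constant curvature geometry hold for all \<open>K\<close> alike.\<close>

definition cs :: "real \<Rightarrow> real \<Rightarrow> real" where
  "cs K z = (if K > 0 then cos (sqrt K * z) else if K = 0 then 1 else cosh (sqrt (- K) * z))"

definition sn :: "real \<Rightarrow> real \<Rightarrow> real" where
  "sn K z = (if K > 0 then sin (sqrt K * z) / sqrt K else if K = 0 then z
             else sinh (sqrt (- K) * z) / sqrt (- K))"

text \<open>The modified distance: the solution of \<open>f'' + K * f = 1\<close> with \<open>f 0 = 0\<close> and \<open>f' 0 = 0\<close>. This form by the
  half angle avoids a division by \<open>K\<close> and makes nonnegativity evident.\<close>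

definition md :: "real \<Rightarrow> real \<Rightarrow> real" where
  "md K z = 2 * (sn K (z / 2))\<^sup>2"

lemma cs_0 [simp]: "cs K 0 = 1" and sn_0 [simp]: "sn K 0 = 0"
  and cs_minus [simp]: "cs K (- z) = cs K z" and sn_minus [simp]: "sn K (- z) = - sn K z"
  by (simp_all add: cs_def sn_def)

lemma cs_add: "cs K (x + y) = cs K x * cs K y - K * sn K x * sn K y"
proof -
  consider "K > 0" | "K = 0" | "K < 0" by linarith
  then show ?thesis
  proof cases
    case 1
    then show ?thesis by (simp add: cs_def sn_def cos_add distrib_left field_simps)
  next
    case 3
    then have "K * (u / sqrt (- K)) * (v / sqrt (- K)) = - (u * v)" for u v
      by (simp add: field_simps)
    with 3 show ?thesis by (simp add: cs_def sn_def cosh_add distrib_left)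
  qed (simp add: cs_def)
qed

lemma sn_add: "sn K (x + y) = sn K x * cs K y + cs K x * sn K y"
  by (auto simp: cs_def sn_def sin_add sinh_add distrib_left add_divide_distrib)

lemma cs_diff: "cs K (x - y) = cs K x * cs K y + K * sn K x * sn K y"
  using cs_add[of K x "- y"] by simp

lemma sn_diff: "sn K (x - y) = sn K x * cs K y - cs K x * sn K y"
  using sn_add[of K x "- y"] by simp

lemma cs_sn_squared: "(cs K x)\<^sup>2 = 1 - K * (sn K x)\<^sup>2"
  using cs_diff[of K x x] by (simp add: power2_eq_square)

lemma cs_eq_md: "cs K z = 1 - K * md K z"
  using cs_add[of K "z/2" "z/2"] cs_sn_squared[of K "z/2"]
  by (simp add: md_def power2_eq_square)

lemma continuous_on_sn [continuous_intros]: "continuous_on S (sn K)"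
  by (cases "K > 0"; cases "K = 0") (auto simp: sn_def[abs_def] intro!: continuous_intros)

text \<open>Distances in the model space are at most \<open>pi / sqrt K\<close> for \<open>K > 0\<close> and unrestricted otherwise. Both are
  expressed by \<open>sqrt K * z \<le> pi\<close>: for \<open>K \<le> 0\<close> the real square root is not positive, and the condition
  holds for all \<open>z \<ge> 0\<close>.\<close>

lemma sn_nonneg: "0 \<le> z \<Longrightarrow> sqrt K * z \<le> pi \<Longrightarrow> 0 \<le> sn K z"
  by (auto simp: sn_def intro!: sin_ge_zero mult_nonneg_nonneg divide_nonneg_nonneg)

lemma sn_pos: "0 < z \<Longrightarrow> sqrt K * z < pi \<Longrightarrow> 0 < sn K z"
  by (auto simp: sn_def intro!: sin_gt_zero divide_pos_pos)

lemma cs_pos: assumes "0 \<le> z" "sqrt K * z < pi / 2" shows "0 < cs K z"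
proof (cases "K > 0")
  case True
  then have "- (pi / 2) < sqrt K * z"
    using assms(1) pi_half_gt_zero
    by (meson less_le_trans mult_nonneg_nonneg neg_less_0_iff_less real_sqrt_ge_zero less_imp_le)
  then show ?thesis using True assms by (simp add: cs_def cos_gt_zero_pi)
qed (simp add: cs_def)

lemma sn_mono:
  assumes "0 \<le> y" "y \<le> z" "sqrt K * z \<le> pi / 2"
  shows "sn K y \<le> sn K z"
proof (cases "K > 0")
  case True
  then have "0 \<le> sqrt K * y" "sqrt K * y \<le> sqrt K * z"
    using assms by auto
  moreover have "- (pi / 2) \<le> sqrt K * y"
    using calculation(1) pi_half_ge_zero by linarith
  ultimately have "sin (sqrt K * y) \<le> sin (sqrt K * z)"
    using assms(3) by (intro sin_monotone_2pi_le) auto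
  then show ?thesis using True by (simp add: sn_def divide_right_mono)
next
  case False
  then show ?thesis using assms by (auto simp: sn_def divide_right_mono mult_left_mono)
qed

lemma md_nonneg [simp]: "0 \<le> md K z"
  and md_0 [simp]: "md K 0 = 0"
  and md_minus [simp]: "md K (- z) = md K z"
  by (simp_all add: md_def)

lemma md_abs [simp]: "md K \<bar>z\<bar> = md K z"
  by (cases "0 \<le> z") simp_all

lemma continuous_on_md: "continuous_on S (md K)"
  unfolding md_def
  by (intro continuous_intros continuous_on_compose2[OF continuous_on_sn[of UNIV]]) auto

lemma md_mono:
  assumes "\<bar>y\<bar> \<le> z" "sqrt K * z \<le> pi"
  shows "md K y \<le> md K z"
proof -
  have "sn K (\<bar>y\<bar> / 2) \<le> sn K (z / 2)"
    using assms by (intro sn_mono) auto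
  moreover have "0 \<le> sn K (\<bar>y\<bar> / 2)"
  proof (rule sn_nonneg)
    show "sqrt K * (\<bar>y\<bar> / 2) \<le> pi"
    proof (cases "K > 0")
      case True
      then have "sqrt K * (\<bar>y\<bar> / 2) \<le> sqrt K * z"
        using assms by (intro mult_left_mono) auto
      then show ?thesis using assms by simp
    next
      case False
      then have "sqrt K * (\<bar>y\<bar> / 2) \<le> 0"
        by (simp add: mult_nonpos_nonneg)
      then show ?thesis using pi_ge_zero by linarith
    qed
  qed simp
  ultimately have "md K \<bar>y\<bar> \<le> md K z"
    unfolding md_def by (simp add: power_mono)
  then show ?thesis by simp
qed

lemma md_add_sub: "md K (x + y) - md K (x - y) = 2 * sn K x * sn K y"
proof -
  have "md K (x + y) - md K (x - y) =
      2 * (sn K (x/2) * cs K (y/2) + cs K (x/2) * sn K (y/2))\<^sup>2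
      - 2 * (sn K (x/2) * cs K (y/2) - cs K (x/2) * sn K (y/2))\<^sup>2"
    by (simp add: md_def sn_add sn_diff add_divide_distrib diff_divide_distrib)
  also have "\<dots> = 2 * (2 * sn K (x/2) * cs K (x/2)) * (2 * sn K (y/2) * cs K (y/2))"
    by algebra
  also have "2 * sn K (x/2) * cs K (x/2) = sn K x"
    using sn_add[of K "x/2" "x/2"] by simp
  also have "2 * sn K (y/2) * cs K (y/2) = sn K y"
    using sn_add[of K "y/2" "y/2"] by simp
  finally show ?thesis .
qed

text \<open>This is behind the theorem of Apollonius: the left-hand side, for a median \<open>x\<close> and half a base \<open>y\<close>, is
  an affine function of \<open>md K x\<close>, with a positive slope if \<open>y\<close> is small.\<close>

lemma md_add_add: "md K (x + y) + md K (x - y) = 2 * md K y + 2 * cs K y * md K x"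
proof -
  have "md K (x + y) + md K (x - y) =
      2 * (sn K (x/2) * cs K (y/2) + cs K (x/2) * sn K (y/2))\<^sup>2
      + 2 * (sn K (x/2) * cs K (y/2) - cs K (x/2) * sn K (y/2))\<^sup>2"
    by (simp add: md_def sn_add sn_diff add_divide_distrib diff_divide_distrib)
  also have "\<dots> = 4 * (sn K (x/2))\<^sup>2 * (cs K (y/2))\<^sup>2 + 4 * (cs K (x/2))\<^sup>2 * (sn K (y/2))\<^sup>2"
    by algebra
  also have "\<dots> = 2 * md K y + 2 * cs K y * md K x"
    unfolding cs_eq_md[of K y] cs_sn_squared md_def by algebra
  finally show ?thesis .
qed

text \<open>Since \<open>sn K\<close> has derivative \<open>1\<close> at \<open>0\<close> for all \<open>K\<close>: in the small, the model spaces are all alike.\<close>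

lemma tendsto_md: "((\<lambda>t. md K (t * z) / t\<^sup>2) \<longlongrightarrow> z\<^sup>2 / 2) (at_right 0)"
proof -
  have "(sn K has_real_derivative 1) (at 0)"
  proof -
    consider "K > 0" | "K = 0" | "K < 0" by linarith
    then show ?thesis
      by cases (auto simp: sn_def[abs_def] intro!: derivative_eq_intros)
  qed
  moreover have "((\<lambda>t. t * (z / 2)) has_real_derivative z / 2) (at 0)"
    by (auto intro!: derivative_eq_intros)
  ultimately have "((\<lambda>t. sn K (t * (z / 2))) has_real_derivative 1 * (z / 2)) (at 0)"
    by (intro DERIV_chain2[where f = "sn K"]) auto
  then have "((\<lambda>t. sn K (t * (z / 2)) / t) \<longlongrightarrow> z / 2) (at 0)"
    by (simp add: has_field_derivative_iff)
  then have "((\<lambda>t. sn K (t * (z / 2)) / t) \<longlongrightarrow> z / 2) (at_right 0)"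
    by (rule tendsto_within_subset) simp
  then have "((\<lambda>t. 2 * (sn K (t * (z / 2)) / t)\<^sup>2) \<longlongrightarrow> 2 * (z / 2)\<^sup>2) (at_right 0)"
    by (intro tendsto_mult tendsto_const tendsto_power)
  then show ?thesis
    by (simp add: md_def power_divide)
qed


section \<open>Distance in the model spaces\<close>

text \<open>The bilinear form whose restriction to the tangent planes of the model space is its metric. For \<open>K > 0\<close> it
  is the scalar product, and for \<open>K < 0\<close> that of Minkowski. For \<open>K = 0\<close> it does not see the third coordinate,
  which vanishes on the plane.\<close>

definition model_form :: "real \<Rightarrow> real^3 \<Rightarrow> real^3 \<Rightarrow> real" where
  "model_form K x y = x$1 * y$1 + x$2 * y$2 + sgn K * (x$3 * y$3)"

lemma form_self_diff: "model_form K (x - y) (x - y) = model_form K x x + model_form K y y - 2 * model_form K x y"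
  by (simp add: model_form_def algebra_simps)

lemma form_comb: "model_form K (\<alpha> *\<^sub>R x + \<beta> *\<^sub>R y) (\<gamma> *\<^sub>R x + \<delta> *\<^sub>R y) =
    \<alpha> * \<gamma> * model_form K x x + \<beta> * \<delta> * model_form K y y + (\<alpha> * \<delta> + \<beta> * \<gamma>) * model_form K x y"
  by (simp add: model_form_def algebra_simps)

lemma form_right_comb: "model_form K a (\<alpha> *\<^sub>R x + \<beta> *\<^sub>R y) = \<alpha> * model_form K a x + \<beta> * model_form K a y"
  by (simp add: model_form_def algebra_simps)

lemma form_commute: "model_form K x y = model_form K y x"
  by (simp add: model_form_def algebra_simps)

lemma form_pos: "K > 0 \<Longrightarrow> model_form K x y = x \<bullet> y"
  by (simp add: model_form_def inner_vec_def sum_3)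

lemma form_neg: "K < 0 \<Longrightarrow> model_form K x y = minkowski x y"
  by (simp add: model_form_def minkowski_def)

text \<open>For \<open>K = 0\<close> the equation \<open>K * model_form K x x = 1\<close> has no solutions, which is why the plane is a separate
  case. Formulas for the squared chord \<open>model_form K (x - y) (x - y)\<close> hold for it too.\<close>

lemma mem_model_space:
  "x \<in> model_space K \<longleftrightarrow>
     (if K = 0 then x$3 = 0 else K * model_form K x x = 1) \<and> (K < 0 \<longrightarrow> x$3 > 0)"
proof -
  consider "K > 0" | "K = 0" | "K < 0" by linarith
  then show ?thesis
  proof cases
    case 1
    have "norm x = 1 / sqrt K \<longleftrightarrow> (norm x)\<^sup>2 = (1 / sqrt K)\<^sup>2"
      using 1 by (simp add: power2_eq_iff_nonneg)
    also have "\<dots> \<longleftrightarrow> K * (x \<bullet> x) = 1"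
      using 1 by (auto simp: power2_norm_eq_inner power_divide field_simps)
    finally show ?thesis using 1 by (simp add: model_space_def form_pos)
  next
    case 3
    then show ?thesis by (auto simp: model_space_def form_neg field_simps)
  qed (simp add: model_space_def)
qed

text \<open>Products obey the simpler identities, whereas chords also describe the distance of the plane; this leads
  from one to the other.\<close>

lemma form_eq_cs:
  assumes "K \<noteq> 0" "x \<in> model_space K" "y \<in> model_space K"
  shows "model_form K (x - y) (x - y) = 2 * md K d \<longleftrightarrow> K * model_form K x y = cs K d"
proof -
  have "K * model_form K (x - y) (x - y) = 2 - 2 * (K * model_form K x y)"
    using assms by (simp add: form_self_diff mem_model_space algebra_simps)
  moreover have "model_form K (x - y) (x - y) = 2 * md K d \<longleftrightarrow> K * model_form K (x - y) (x - y) = K * (2 * md K d)"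
    using assms by simp
  ultimately show ?thesis by (auto simp: cs_eq_md)
qed

text \<open>Below, distances are computed from squared chords, whose formula is the same for all \<open>K\<close>, and not from
  the inverse functions in \<^const>\<open>model_dist\<close>.\<close>

lemma model_dist_eq:
  assumes "x \<in> model_space K" "y \<in> model_space K"
    and "model_form K (x - y) (x - y) = 2 * md K d" "0 \<le> d" "sqrt K * d \<le> pi"
  shows "model_dist K x y = d"
proof -
  consider "K > 0" | "K = 0" | "K < 0" by linarith
  then show ?thesis
  proof cases
    case 1
    then show ?thesis
      using assms form_eq_cs[of K x y d] by (simp add: model_dist_def form_pos cs_def arccos_cos)
  next
    case 2
    then have "(x - y) \<bullet> (x - y) = model_form K (x - y) (x - y)"
      using assms(1,2) by (simp add: model_form_def inner_vec_def sum_3 mem_model_space)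
    then have "(dist x y)\<^sup>2 = d\<^sup>2"
      using assms(3) 2 by (simp add: dist_norm power2_norm_eq_inner md_def sn_def power_divide)
    then show ?thesis
      using 2 assms(4) by (simp add: model_dist_def power2_eq_iff_nonneg)
  next
    case 3
    then show ?thesis
      using assms form_eq_cs[of K x y d]
      by (simp add: model_dist_def form_neg cs_def arcosh_cosh_real)
  qed
qed

text \<open>Geodesic polar coordinates about the pole. For \<open>K = 0\<close> the third coordinate is a quotient by zero, hence
  \<open>0\<close>, as it should be on the plane.\<close>

definition polar :: "real \<Rightarrow> real \<Rightarrow> real \<Rightarrow> real^3" where
  "polar K r \<phi> = vector [sn K r * cos \<phi>, sn K r * sin \<phi>, cs K r / sqrt \<bar>K\<bar>]"

lemma polar_in_model_space: "polar K r \<phi> \<in> model_space K"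
proof -
  have "model_form K (polar K r \<phi>) (polar K r \<phi>) =
      (sn K r)\<^sup>2 * ((sin \<phi>)\<^sup>2 + (cos \<phi>)\<^sup>2) + sgn K * ((cs K r)\<^sup>2 / \<bar>K\<bar>)"
    by (simp add: model_form_def polar_def power2_eq_square algebra_simps
        del: sin_cos_squared_add sin_cos_squared_add3)
  then have "model_form K (polar K r \<phi>) (polar K r \<phi>) = 1 / K" if "K \<noteq> 0"
    using that by (cases "K > 0") (simp_all add: cs_sn_squared field_simps)
  then show ?thesis
    by (auto simp: mem_model_space) (simp_all add: polar_def cs_def)
qed

lemma law_of_cosines:
  "model_form K (polar K p \<phi> - polar K q \<psi>) (polar K p \<phi> - polar K q \<psi>) =
     2 * md K (p - q) + 2 * sn K p * sn K q * (1 - cos (\<phi> - \<psi>))"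
proof (cases "K = 0")
  case True
  have "(p * cos \<phi> - q * cos \<psi>)\<^sup>2 + (p * sin \<phi> - q * sin \<psi>)\<^sup>2 =
      p\<^sup>2 * ((sin \<phi>)\<^sup>2 + (cos \<phi>)\<^sup>2) + q\<^sup>2 * ((sin \<psi>)\<^sup>2 + (cos \<psi>)\<^sup>2)
        - 2 * p * q * (cos \<phi> * cos \<psi> + sin \<phi> * sin \<psi>)"
    by algebra
  also have "\<dots> = (p - q)\<^sup>2 + 2 * p * q * (1 - cos (\<phi> - \<psi>))"
    by (simp add: cos_diff power2_eq_square algebra_simps)
  finally show ?thesis
    using True by (simp add: model_form_def polar_def md_def sn_def cs_def power_divide flip: power2_eq_square)
next
  case False
  have "K * model_form K (polar K p \<phi>) (polar K q \<psi>) = cs K p * cs K q + K * (sn K p * sn K q * cos (\<phi> - \<psi>))"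
    using False by (auto simp: model_form_def polar_def cos_diff sgn_real_def field_simps)
  then have "K * model_form K (polar K p \<phi> - polar K q \<psi>) (polar K p \<phi> - polar K q \<psi>) =
      2 - 2 * (cs K p * cs K q + K * (sn K p * sn K q * cos (\<phi> - \<psi>)))"
    using False polar_in_model_space[of K p \<phi>] polar_in_model_space[of K q \<psi>]
    by (simp add: form_self_diff mem_model_space algebra_simps)
  also have "\<dots> = K * (2 * md K (p - q) + 2 * sn K p * sn K q * (1 - cos (\<phi> - \<psi>)))"
    using cs_eq_md[of K "p - q"] by (simp add: cs_diff algebra_simps)
  finally show ?thesis using False by simp
qed


section \<open>Geodesics of the model spaces\<close>

lemma distance_realizer_constant_speed:
  assumes "path g" "path_image g \<subseteq> S" "pathstart g = x" "pathfinish g = y"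
    and speed: "\<And>s t. 0 \<le> s \<Longrightarrow> s \<le> t \<Longrightarrow> t \<le> 1 \<Longrightarrow> d (g s) (g t) = (t - s) * l"
    and "0 \<le> l"
  shows "distance_realizer S d x y g"
proof -
  have len: "(\<Sum>i < length ts - 1. d (g (ts ! i)) (g (ts ! Suc i))) =
      (\<Sum>i < length ts - 1. \<bar>ts ! i - ts ! Suc i\<bar>) * l"
    if ts: "sorted ts" "set ts \<subseteq> {0..1}" for ts
    unfolding sum_distrib_right
  proof (rule sum.cong)
    fix i assume "i \<in> {..<length ts - 1}"
    then have "ts ! i \<le> ts ! Suc i" "ts ! i \<in> set ts" "ts ! Suc i \<in> set ts"
      using sorted_nth_mono[OF ts(1), of i "Suc i"] by simp_all
    then show "d (g (ts ! i)) (g (ts ! Suc i)) = \<bar>ts ! i - ts ! Suc i\<bar> * l"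
      using speed[of "ts ! i" "ts ! Suc i"] ts(2) by (simp add: subset_iff)
  qed simp
  have xy: "d x y = l"
    using speed[of 0 1] assms(3,4) by (simp add: pathstart_def pathfinish_def)
  have "curve_length d g = ereal (d x y)"
    unfolding curve_length_def
  proof (rule antisym)
    show "(SUP ts\<in>{ts. sorted ts \<and> set ts \<subseteq> {0..1}}.
        ereal (\<Sum>i<length ts - 1. d (g (ts ! i)) (g (ts ! Suc i)))) \<le> ereal (d x y)"
    proof (rule SUP_least)
      fix ts :: "real list" assume "ts \<in> {ts. sorted ts \<and> set ts \<subseteq> {0..1}}"
      then have ts: "sorted ts" "set ts \<subseteq> {0..1}" by simp_all
      have "(\<Sum>i<length ts - 1. \<bar>ts ! i - ts ! Suc i\<bar>) \<le> 1"
      proof (cases "ts = []")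
        case False
        then have "last ts \<in> {0..1}" "hd ts \<in> {0..1}"
          using ts(2) last_in_set[OF False] hd_in_set[OF False] by (blast, blast)
        then show ?thesis using sum_telescope_sorted[OF ts(1) False] by simp
      qed simp
      then have "(\<Sum>i<length ts - 1. \<bar>ts ! i - ts ! Suc i\<bar>) * l \<le> 1 * l"
        using \<open>0 \<le> l\<close> by (rule mult_right_mono)
      then show "ereal (\<Sum>i<length ts - 1. d (g (ts ! i)) (g (ts ! Suc i))) \<le> ereal (d x y)"
        using len[OF ts] xy by simp
    qed
    show "ereal (d x y) \<le> (SUP ts\<in>{ts. sorted ts \<and> set ts \<subseteq> {0..1}}.
        ereal (\<Sum>i<length ts - 1. d (g (ts ! i)) (g (ts ! Suc i))))"
      using len[of "[0, 1]"] xy by (intro SUP_upper2[of "[0, 1]"]) auto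
  qed
  then show ?thesis using assms(1-4) by (simp add: distance_realizer_def)
qed

text \<open>The geodesic between points at distance \<open>r\<close>, which becomes the segment for \<open>K = 0\<close>.\<close>

definition geodesic :: "real \<Rightarrow> real \<Rightarrow> real^3 \<Rightarrow> real^3 \<Rightarrow> real \<Rightarrow> real^3" where
  "geodesic K r x y s =
     (sn K ((1 - s) * r) / sn K r) *\<^sub>R x + (sn K (s * r) / sn K r) *\<^sub>R y"

text \<open>For \<open>K < 0\<close> multiplication by \<open>sqrt K\<close> reverses the inequality, but then the product is not positive.\<close>

lemma scaled_less_pi_mono:
  assumes "0 \<le> u" "u \<le> v" "sqrt K * v < pi"
  shows "sqrt K * u < pi"
proof (cases "K > 0")
  case True
  then have "sqrt K * u \<le> sqrt K * v"
    using assms by (intro mult_left_mono) auto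
  then show ?thesis using assms by simp
next
  case False
  then have "sqrt K * u \<le> 0"
    using assms by (simp add: mult_nonpos_nonneg)
  then show ?thesis using pi_gt_zero by linarith
qed

context
  fixes K r :: real and x y :: "real^3"
  assumes x: "x \<in> model_space K" and y: "y \<in> model_space K"
    and r: "0 < r" "sqrt K * r < pi"
    and xy: "model_form K (x - y) (x - y) = 2 * md K r"
begin

lemma geodesic_flat: "K = 0 \<Longrightarrow> geodesic K r x y s = (1 - s) *\<^sub>R x + s *\<^sub>R y"
  using r by (simp add: geodesic_def sn_def)

text \<open>The coefficients of the geodesic are chosen so that this product, by the addition theorems, depends on the
  difference of the parameters only, which means constant speed.\<close>

lemma form_geodesic:
  assumes "K \<noteq> 0"
  shows "K * model_form K (geodesic K r x y s) (geodesic K r x y t) = cs K ((t - s) * r)"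
proof -
  have S: "sn K r > 0" using r by (rule sn_pos)
  have xx: "K * model_form K x x = 1" "K * model_form K y y = 1"
    using x y assms by (simp_all add: mem_model_space)
  have C: "K * model_form K x y = cs K r"
    using form_eq_cs[OF assms x y, of r] xy by blast
  let ?a = "\<lambda>s. sn K ((1 - s) * r)" and ?b = "\<lambda>s. sn K (s * r)"
  have a: "?a s = sn K r * cs K (s * r) - cs K r * sn K (s * r)" for s
    by (simp add: left_diff_distrib sn_diff)
  have "K * model_form K (geodesic K r x y s) (geodesic K r x y t) =
     (?a s / sn K r) * (?a t / sn K r) * (K * model_form K x x) + (?b s / sn K r) * (?b t / sn K r) * (K * model_form K y y)
       + ((?a s / sn K r) * (?b t / sn K r) + (?b s / sn K r) * (?a t / sn K r)) * (K * model_form K x y)"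
    unfolding geodesic_def form_comb by (simp only: distrib_left mult_ac)
  also have "\<dots> = (?a s * ?a t + ?b s * ?b t + (?a s * ?b t + ?b s * ?a t) * cs K r) / (sn K r)\<^sup>2"
    unfolding xx C by (simp add: power2_eq_square add_divide_distrib algebra_simps)
  also have "?a s * ?a t + ?b s * ?b t + (?a s * ?b t + ?b s * ?a t) * cs K r =
      (sn K r)\<^sup>2 * (cs K (t * r) * cs K (s * r)) + (1 - (cs K r)\<^sup>2) * (sn K (t * r) * sn K (s * r))"
    unfolding a by algebra
  also have "\<dots> = (sn K r)\<^sup>2 * cs K ((t - s) * r)"
    by (simp add: cs_sn_squared left_diff_distrib cs_diff algebra_simps)
  finally show ?thesis using S by simp
qed

lemma geodesic_in_model_space:
  assumes "0 \<le> s" "s \<le> 1"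
  shows "geodesic K r x y s \<in> model_space K"
proof -
  have "sqrt K * ((1 - s) * r) \<le> pi" "sqrt K * (s * r) \<le> pi"
    using assms r by (auto intro!: less_imp_le[OF scaled_less_pi_mono[OF _ _ r(2)]] mult_left_le_one_le)
  then have ge: "0 \<le> sn K ((1 - s) * r)" "0 \<le> sn K (s * r)"
    using assms r by (auto intro!: sn_nonneg)
  have "geodesic K r x y s $ 3 > 0" if "K < 0"
  proof -
    have pos: "0 < x $ 3" "0 < y $ 3" "0 < sn K r"
      using that x y sn_pos[OF r] by (auto simp: mem_model_space)
    show ?thesis
    proof (cases "s = 0")
      case True
      then show ?thesis using pos by (simp add: geodesic_def)
    next
      case False
      then have "0 < sn K (s * r)"
        using assms r that by (intro sn_pos) (auto intro!: scaled_less_pi_mono[OF _ _ r(2)] mult_left_le_one_le)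
      then show ?thesis
        using pos ge by (simp add: geodesic_def add_nonneg_pos)
    qed
  qed
  moreover have "geodesic K r x y s $ 3 = 0" if "K = 0"
    using that x y by (simp add: geodesic_def mem_model_space)
  moreover have "K * model_form K (geodesic K r x y s) (geodesic K r x y s) = 1" if "K \<noteq> 0"
    using form_geodesic[OF that, of s s] by simp
  ultimately show ?thesis by (simp add: mem_model_space)
qed

lemma form_geodesic_diff:
  assumes "0 \<le> s" "s \<le> 1" "0 \<le> t" "t \<le> 1"
  shows "model_form K (geodesic K r x y s - geodesic K r x y t) (geodesic K r x y s - geodesic K r x y t)
    = 2 * md K ((t - s) * r)"
proof (cases "K = 0")
  case True
  have "geodesic K r x y s - geodesic K r x y t = (t - s) *\<^sub>R (x - y)"
    by (simp add: geodesic_flat[OF True] algebra_simps)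
  then have "model_form K (geodesic K r x y s - geodesic K r x y t) (geodesic K r x y s - geodesic K r x y t)
      = (t - s)\<^sup>2 * model_form K (x - y) (x - y)"
    using form_comb[of K "t - s" "x - y" 0 0 "t - s" 0] by (simp add: power2_eq_square)
  then show ?thesis
    using True xy by (simp add: md_def sn_def power_divide power_mult_distrib)
next
  case False
  then show ?thesis
    using form_geodesic[OF False, of s t] assms
    by (subst form_eq_cs[OF False]) (auto intro: geodesic_in_model_space)
qed

lemma model_dist_geodesic:
  assumes "0 \<le> s" "s \<le> t" "t \<le> 1"
  shows "model_dist K (geodesic K r x y s) (geodesic K r x y t) = (t - s) * r"
proof (rule model_dist_eq)
  show "sqrt K * ((t - s) * r) \<le> pi"
    using assms r by (auto intro!: less_imp_le[OF scaled_less_pi_mono[OF _ _ r(2)]] mult_left_le_one_le)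
qed (use assms r in \<open>auto intro!: geodesic_in_model_space form_geodesic_diff\<close>)

lemma geodesic_endpoints: "geodesic K r x y 0 = x" "geodesic K r x y 1 = y"
  using sn_pos[OF r] by (simp_all add: geodesic_def)

lemma distance_realizer_geodesic:
  "distance_realizer (model_space K) (model_dist K) x y (geodesic K r x y)"
proof (rule distance_realizer_constant_speed)
  show "path (geodesic K r x y)"
    unfolding path_def geodesic_def using sn_pos[OF r]
    by (intro continuous_intros continuous_on_compose2[OF continuous_on_sn[of UNIV]]) auto
  show "path_image (geodesic K r x y) \<subseteq> model_space K"
    using geodesic_in_model_space by (auto simp: path_image_def)
qed (use r geodesic_endpoints model_dist_geodesic in
     \<open>auto simp: pathstart_def pathfinish_def\<close>)

text \<open>The theorem of Apollonius. For \<open>K \<noteq> 0\<close> the midpoint is the sum of the endpoints divided by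
  \<open>2 * cs K (r / 2)\<close>, so its product with \<open>a\<close> is a combination of the products of \<open>a\<close> with the endpoints; for
  \<open>K = 0\<close> it is the parallelogram law of the plane. The median length \<open>m\<close> enters through its equation
  only, so that its existence can be settled separately.\<close>

lemma form_midpoint:
  assumes a: "a \<in> model_space K"
    and p: "model_form K (a - x) (a - x) = 2 * md K p" and q: "model_form K (a - y) (a - y) = 2 * md K q"
    and r2: "cs K (r / 2) \<noteq> 0"
    and m: "md K p + md K q = 2 * md K (r / 2) + 2 * cs K (r / 2) * md K m"
  shows "model_form K (a - geodesic K r x y (1/2)) (a - geodesic K r x y (1/2)) = 2 * md K m"
proof (cases "K = 0")
  case True
  have "a - geodesic K r x y (1/2) = (1/2) *\<^sub>R (a - x) + (1/2) *\<^sub>R (a - y)"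
    by (simp add: geodesic_flat[OF True] vec_eq_iff field_simps)
  moreover have "x - y = (a - y) - (a - x)"
    by simp
  ultimately have "model_form K (a - geodesic K r x y (1/2)) (a - geodesic K r x y (1/2)) =
      model_form K (a - x) (a - x) / 2 + model_form K (a - y) (a - y) / 2 - model_form K (x - y) (x - y) / 4"
    by (simp only: form_comb form_self_diff[of K "a - y" "a - x"])
      (simp add: form_commute[of K "a - y" "a - x"] diff_divide_distrib add_divide_distrib)
  then show ?thesis
    using p q xy m True by (simp add: md_def sn_def cs_def power_divide)
next
  case False
  have "sn K r = 2 * sn K (r / 2) * cs K (r / 2)"
    using sn_add[of K "r/2" "r/2"] by simp
  then have w: "sn K (r / 2) / sn K r = 1 / (2 * cs K (r / 2))"
    using sn_pos[OF r] by (auto simp: field_simps)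
  have "K * model_form K a (geodesic K r x y (1/2)) =
      sn K (r / 2) / sn K r * (K * model_form K a x) + sn K (r / 2) / sn K r * (K * model_form K a y)"
    by (simp add: geodesic_def form_right_comb algebra_simps)
  also have "\<dots> = (cs K p + cs K q) / (2 * cs K (r / 2))"
    using p q form_eq_cs[OF False a x] form_eq_cs[OF False a y] by (simp add: w add_divide_distrib)
  also have "cs K p + cs K q = 2 - K * (md K p + md K q)"
    by (simp add: cs_eq_md algebra_simps)
  also have "\<dots> = 2 * cs K (r / 2) * cs K m"
    unfolding m by (simp add: cs_eq_md algebra_simps)
  finally show ?thesis
    using r2 by (subst form_eq_cs[OF False a]) (auto intro: geodesic_in_model_space)
qed

end


section \<open>Comparison triangles and their medians\<close>

text \<open>The triangle is placed with the vertex \<open>a\<close> at the pole. By the law of cosines the angle at \<open>a\<close> exists if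
  \<open>md K r\<close> lies between \<open>md K (p - q)\<close> and \<open>md K (p + q)\<close>, which is the triangle inequality.\<close>

lemma exists_comparison_points:
  assumes pos: "0 < p" "0 < q" "0 \<le> r"
    and tri: "p \<le> q + r" "q \<le> p + r" "r \<le> p + q"
    and small: "sqrt K * (p + q + r) < pi"
  obtains a b c where "a \<in> model_space K" "b \<in> model_space K" "c \<in> model_space K"
    "model_form K (a - b) (a - b) = 2 * md K p" "model_form K (a - c) (a - c) = 2 * md K q"
    "model_form K (b - c) (b - c) = 2 * md K r"
proof -
  have sp: "0 < sn K p" "0 < sn K q"
    using pos by (auto intro!: sn_pos scaled_less_pi_mono[OF _ _ small])
  have lo: "md K (p - q) \<le> md K r"
    using pos tri by (intro md_mono less_imp_le[OF scaled_less_pi_mono[OF _ _ small]]) auto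
  have "md K r \<le> md K (p + q)"
    using pos tri by (intro md_mono less_imp_le[OF scaled_less_pi_mono[OF _ _ small]]) auto
  then have hi: "md K r - md K (p - q) \<le> 2 * (sn K p * sn K q)"
    using md_add_sub[of K p q] by simp
  define C where "C = 1 - (md K r - md K (p - q)) / (sn K p * sn K q)"
  have C: "-1 \<le> C" "C \<le> 1"
    using lo hi sp by (simp_all add: C_def pos_divide_le_eq)
  let ?a = "polar K 0 0" and ?b = "polar K p (arccos C)" and ?c = "polar K q 0"
  show thesis
  proof
    show "model_form K (?a - ?b) (?a - ?b) = 2 * md K p" "model_form K (?a - ?c) (?a - ?c) = 2 * md K q"
      by (simp_all add: law_of_cosines)
    show "model_form K (?b - ?c) (?b - ?c) = 2 * md K r"
      using C sp by (simp add: law_of_cosines cos_arccos) (simp add: C_def)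
  qed (rule polar_in_model_space)+
qed

text \<open>By the intermediate value theorem on \<open>{0..p + r / 2}\<close>. At the left end, \<open>r \<le> p + q\<close> is used; at the right
  end, \<open>m + r / 2 = p + r \<ge> q\<close> and \<open>m - r / 2 = p\<close>. For \<open>K > 0\<close> the perimeter is restricted to half
  of what a comparison triangle may have, so that \<open>cs K\<close> is positive at \<open>(p + q) / 2\<close> and \<open>md K\<close> is increasing
  up to \<open>p + r\<close>.\<close>

lemma exists_median_length:
  assumes pos: "0 < p" "0 < q" "0 \<le> r"
    and tri: "q \<le> p + r" "r \<le> p + q"
    and small: "sqrt K * (p + q + r) < pi"
  obtains m where "0 \<le> m" "m \<le> p + r / 2"
    "md K p + md K q = 2 * md K (r / 2) + 2 * cs K (r / 2) * md K m"
proof -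
  let ?f = "\<lambda>m. 2 * md K (r / 2) + 2 * cs K (r / 2) * md K m"
  have "\<exists>m. 0 \<le> m \<and> m \<le> p + r / 2 \<and> ?f m = md K p + md K q"
  proof (rule IVT')
    have "?f 0 = 2 * md K (r / 2)"
      by simp
    also have "\<dots> \<le> 2 * md K ((p + q) / 2)"
      using pos tri
      by (intro mult_left_mono md_mono less_imp_le[OF scaled_less_pi_mono[OF _ _ small]]) auto
    also have "\<dots> \<le> 2 * md K ((p + q) / 2) + 2 * cs K ((p + q) / 2) * md K ((p - q) / 2)"
    proof -
      have "sqrt K * ((p + q) / 2) < pi / 2"
        using scaled_less_pi_mono[OF _ _ small, of "p + q"] pos by simp
      then have "0 < cs K ((p + q) / 2)"
        using pos by (intro cs_pos) auto
      then show ?thesis by simp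
    qed
    also have "\<dots> = md K ((p - q) / 2 + (p + q) / 2) + md K ((p - q) / 2 - (p + q) / 2)"
      by (simp only: md_add_add)
    also have "\<dots> = md K p + md K q"
      by (simp add: field_simps)
    finally show "?f 0 \<le> md K p + md K q" .
    have "md K q \<le> md K (p + r)"
      using pos tri by (intro md_mono less_imp_le[OF scaled_less_pi_mono[OF _ _ small]]) auto
    then have "md K p + md K q \<le> md K (p + r / 2 + r / 2) + md K (p + r / 2 - r / 2)"
      by (simp add: add.commute)
    then show "md K p + md K q \<le> ?f (p + r / 2)"
      by (simp only: md_add_add)
  qed (use pos in \<open>auto intro!: continuous_intros continuous_on_md\<close>)
  then show thesis using that by metis
qed

text \<open>The content of a curvature bound for straight triangles, stated by the equation for the median of the
  comparison triangle. From here on the model spaces occur only through \<^const>\<open>md\<close> and \<^const>\<open>cs\<close>.\<close>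

lemma median_comparison:
  fixes a b c :: "'a::real_normed_vector" and U :: "'a set"
  assumes comp: "triangle_comparison R K U"
    and sub: "closed_segment a b \<subseteq> U" "closed_segment b c \<subseteq> U" "closed_segment a c \<subseteq> U"
    and ne: "a \<noteq> b" "b \<noteq> c" "a \<noteq> c"
    and small: "sqrt K * (dist a b + dist a c + dist b c) < pi"
  obtains m where "0 \<le> m" "m \<le> dist a b + dist b c / 2" "R (dist a (midpoint b c)) m"
    "md K (dist a b) + md K (dist a c) =
       2 * md K (dist b c / 2) + 2 * cs K (dist b c / 2) * md K m"
proof -
  define p q r where "p = dist a b" and "q = dist a c" and "r = dist b c"
  have pos: "0 < p" "0 < q" "0 < r"
    using ne by (simp_all add: p_def q_def r_def)
  have tri: "p \<le> q + r" "q \<le> p + r" "r \<le> p + q"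
    unfolding p_def q_def r_def
    using dist_triangle[of a b c] dist_triangle[of a c b] dist_triangle[of b c a]
    by (simp_all add: dist_commute)
  have small': "sqrt K * (p + q + r) < pi"
    using small by (simp add: p_def q_def r_def)
  obtain a' b' c' where mem: "a' \<in> model_space K" "b' \<in> model_space K" "c' \<in> model_space K"
    and form: "model_form K (a' - b') (a' - b') = 2 * md K p" "model_form K (a' - c') (a' - c') = 2 * md K q"
      "model_form K (b' - c') (b' - c') = 2 * md K r"
    using exists_comparison_points[OF pos(1,2) less_imp_le[OF pos(3)] tri small'] by metis
  obtain m where m: "0 \<le> m" "m \<le> p + r / 2"
    "md K p + md K q = 2 * md K (r / 2) + 2 * cs K (r / 2) * md K m"
    using exists_median_length[OF pos(1,2) less_imp_le[OF pos(3)] tri(2,3) small'] by metis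
  have lt: "sqrt K * p < pi" "sqrt K * q < pi" "sqrt K * r < pi" "sqrt K * m < pi"
    using pos m by (auto intro!: scaled_less_pi_mono[OF _ _ small'])
  let ?g = "geodesic K r b' c'"
  have g_ends: "?g 0 = b'" "?g 1 = c'"
    using geodesic_endpoints[OF mem(2,3) pos(3) lt(3) form(3)] by simp_all
  have tri_U: "triangle U dist a b c (linepath a b) (linepath b c) (linepath a c)"
    using sub
    by (simp add: triangle_def distance_realizer_def
        linepath_distance_realizer[unfolded distance_realizer_def])
  have "triangle (model_space K) (model_dist K) a' b' c'
      (geodesic K p a' b') ?g (geodesic K q a' c')"
    unfolding triangle_def using mem form pos lt by (auto intro!: distance_realizer_geodesic)
  moreover have "model_dist K a' b' = dist a b" "model_dist K b' c' = dist b c"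
      "model_dist K a' c' = dist a c"
    using mem form pos lt by (auto intro!: model_dist_eq simp flip: p_def q_def r_def)
  moreover have "dist a b + dist b c + dist a c < 2 * pi / sqrt K" if "K > 0"
  proof -
    have "sqrt K * (p + q + r) < 2 * pi"
      using small' pi_gt_zero by linarith
    then show ?thesis
      using that by (simp add: p_def q_def r_def field_simps)
  qed
  ultimately have "comparison_triangle K a b c a' b' c' (geodesic K p a' b') ?g (geodesic K q a' c')"
    unfolding comparison_triangle_def by blast
  moreover have "midpoint b c \<in> path_image (linepath b c)"
    by simp
  moreover have "?g (1/2) \<in> path_image ?g"
    by (simp add: path_image_def)
  moreover have "model_dist K b' (?g (1/2)) = dist b (midpoint b c)"
    using model_dist_geodesic[OF mem(2,3) pos(3) lt(3) form(3), of 0 "1/2"] g_ends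
    by (simp add: dist_midpoint r_def)
  moreover have "model_dist K (?g (1/2)) c' = dist (midpoint b c) c"
    using model_dist_geodesic[OF mem(2,3) pos(3) lt(3) form(3), of "1/2" 1] g_ends
    by (simp add: dist_midpoint r_def)
  ultimately have "R (dist a (midpoint b c)) (model_dist K a' (?g (1/2)))"
    using comp tri_U unfolding triangle_comparison_def by blast
  moreover have "model_dist K a' (?g (1/2)) = m"
  proof (rule model_dist_eq)
    have "sqrt K * (r / 2) < pi / 2"
      using lt(3) by simp
    then have "cs K (r / 2) \<noteq> 0"
      using cs_pos[of "r / 2" K] pos by simp
    then show "model_form K (a' - ?g (1/2)) (a' - ?g (1/2)) = 2 * md K m"
      using m mem form pos lt by (intro form_midpoint) auto
    show "?g (1/2) \<in> model_space K"
      using mem form pos lt by (intro geodesic_in_model_space) auto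
  qed (use mem m lt in auto)
  ultimately show thesis
    using that m by (simp add: p_def q_def r_def)
qed


section \<open>Small triangles\<close>

text \<open>The amount by which a median of length \<open>h\<close> violates the theorem of Apollonius.\<close>

definition median_defect :: "real \<Rightarrow> real \<Rightarrow> real \<Rightarrow> real \<Rightarrow> real \<Rightarrow> real" where
  "median_defect K p q r h = md K (h + r / 2) + md K (h - r / 2) - (md K p + md K q)"

lemma median_defect_limit:
  "((\<lambda>t. median_defect K (t * p) (t * q) (t * r) (t * h) / t\<^sup>2)
     \<longlongrightarrow> h\<^sup>2 + (r / 2)\<^sup>2 - (p\<^sup>2 + q\<^sup>2) / 2) (at_right 0)"
proof -
  have "((\<lambda>t. md K (t * (h + r / 2)) / t\<^sup>2 + md K (t * (h - r / 2)) / t\<^sup>2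
      - (md K (t * p) / t\<^sup>2 + md K (t * q) / t\<^sup>2))
     \<longlongrightarrow> (h + r / 2)\<^sup>2 / 2 + (h - r / 2)\<^sup>2 / 2 - (p\<^sup>2 / 2 + q\<^sup>2 / 2)) (at_right 0)"
    by (intro tendsto_add tendsto_diff tendsto_md)
  moreover have "(h + r / 2)\<^sup>2 / 2 + (h - r / 2)\<^sup>2 / 2 - (p\<^sup>2 / 2 + q\<^sup>2 / 2) = h\<^sup>2 + (r / 2)\<^sup>2 - (p\<^sup>2 + q\<^sup>2) / 2"
    by (simp add: power2_eq_square field_simps)
  ultimately show ?thesis
    by (simp add: median_defect_def add_divide_distrib diff_divide_distrib distrib_left right_diff_distrib)
qed

text \<open>A longer median has a larger defect, and that of the model space has defect \<open>0\<close>. The bounds \<open>p + r / 2\<close> keep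
  both medians in the range where \<open>md K\<close> is increasing.\<close>

lemma median_defect_sign:
  assumes h: "0 \<le> h" "h \<le> p + r / 2" and m: "0 \<le> m" "m \<le> p + r / 2"
    and pos: "0 \<le> p" "0 \<le> q" "0 \<le> r"
    and small: "sqrt K * (p + q + r) < pi"
    and med: "md K p + md K q = 2 * md K (r / 2) + 2 * cs K (r / 2) * md K m"
    and R: "R = (\<le>) \<or> R = (\<ge>)" "R h m"
  shows "R (median_defect K p q r h) 0"
proof -
  have defect: "median_defect K p q r h = 2 * cs K (r / 2) * (md K h - md K m)"
    unfolding median_defect_def md_add_add med by (simp add: algebra_simps)
  have "sqrt K * (r / 2) < pi / 2"
    using scaled_less_pi_mono[OF _ _ small, of r] pos by simp
  then have c: "0 < cs K (r / 2)"
    using pos by (intro cs_pos) auto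
  have lt: "sqrt K * h < pi" "sqrt K * m < pi"
    using h m pos by (auto intro!: scaled_less_pi_mono[OF _ _ small])
  have "median_defect K p q r h \<ge> 0" if "m \<le> h"
    using md_mono[of m h K] that m lt c by (simp add: defect)
  moreover have "median_defect K p q r h \<le> 0" if "h \<le> m"
    using md_mono[of h m K] that h lt c by (simp add: defect mult_le_0_iff)
  ultimately show ?thesis
    using R by auto
qed

text \<open>Scaling by a small \<open>t\<close> brings the triangle with vertices \<open>0\<close>, \<open>x\<close>, \<open>y\<close> into \<open>U\<close> and, for \<open>K > 0\<close>,
  makes its perimeter less than \<open>pi / sqrt K\<close>.\<close>

lemma eventually_median_comparison:
  fixes x y :: "'a::real_normed_vector" and U :: "'a set"
  assumes comp: "triangle_comparison R K U" and U: "0 \<in> interior U"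
    and R: "R = (\<le>) \<or> R = (\<ge>)"
    and ne: "x \<noteq> 0" "y \<noteq> 0" "x \<noteq> y"
  defines "p \<equiv> norm x" and "q \<equiv> norm y" and "r \<equiv> norm (x - y)" and "h \<equiv> norm (x + y) / 2"
  shows "\<forall>\<^sub>F t in at_right 0. R (median_defect K (t * p) (t * q) (t * r) (t * h)) 0"
proof -
  obtain e where e: "0 < e" "ball 0 e \<subseteq> U"
    using U by (auto simp: mem_interior)
  have "((\<lambda>t. t * (p + q)) \<longlongrightarrow> 0 * (p + q)) (at_right 0)"
    by (intro tendsto_intros)
  then have ev1: "\<forall>\<^sub>F t in at_right 0. t * (p + q) < e"
    using order_tendstoD(2)[OF _ e(1)] by simp
  have "((\<lambda>t. sqrt K * (t * (p + q + r))) \<longlongrightarrow> sqrt K * (0 * (p + q + r))) (at_right 0)"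
    by (intro tendsto_intros)
  then have ev2: "\<forall>\<^sub>F t in at_right 0. sqrt K * (t * (p + q + r)) < pi"
    using order_tendstoD(2)[OF _ pi_gt_zero] by simp
  show ?thesis
    using ev1 ev2 eventually_at_right_less[of 0]
  proof eventually_elim
    case (elim t)
    have d: "dist 0 (t *\<^sub>R x) = t * p" "dist 0 (t *\<^sub>R y) = t * q" "dist (t *\<^sub>R x) (t *\<^sub>R y) = t * r"
      using elim(3) by (simp_all add: p_def q_def r_def dist_norm flip: scaleR_diff_right)
    have "midpoint (t *\<^sub>R x) (t *\<^sub>R y) = (t / 2) *\<^sub>R (x + y)"
      by (simp add: midpoint_def scaleR_add_right)
    then have dm: "dist 0 (midpoint (t *\<^sub>R x) (t *\<^sub>R y)) = t * h"
      using elim(3) by (simp add: h_def)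
    have "0 \<le> t * p" "0 \<le> t * q"
      using elim(3) by (simp_all add: p_def q_def)
    then have "t * p < e" "t * q < e"
      using elim(1) by (simp_all add: distrib_left)
    then have ball: "0 \<in> ball (0::'a) e" "t *\<^sub>R x \<in> ball 0 e" "t *\<^sub>R y \<in> ball 0 e"
      using e(1) d by simp_all
    have seg: "closed_segment u v \<subseteq> U" if "u \<in> ball 0 e" "v \<in> ball 0 e" for u v :: 'a
      using closed_segment_subset[OF that convex_ball] e(2) by blast
    have sm: "sqrt K * (t * p + t * q + t * r) < pi"
      using elim(2) by (simp add: distrib_left)
    obtain m where m: "0 \<le> m" "m \<le> t * p + t * r / 2" "R (t * h) m"
      "md K (t * p) + md K (t * q) = 2 * md K (t * r / 2) + 2 * cs K (t * r / 2) * md K m"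
      using median_comparison[OF comp, of 0 "t *\<^sub>R x" "t *\<^sub>R y"] seg ball ne elim(3) sm
      unfolding d dm by auto
    have "norm (x + y) = norm (2 *\<^sub>R x - (x - y))"
      by (simp add: scaleR_2)
    also have "\<dots> \<le> 2 * norm x + norm (x - y)"
      using norm_triangle_ineq4[of "2 *\<^sub>R x" "x - y"] by simp
    finally have "h \<le> p + r / 2"
      by (simp add: h_def p_def r_def)
    then have "t * h \<le> t * (p + r / 2)"
      using elim(3) by (intro mult_left_mono) auto
    then have h: "t * h \<le> t * p + t * r / 2"
      by (simp add: distrib_left)
    have nonneg: "0 \<le> t * h" "0 \<le> t * p" "0 \<le> t * q" "0 \<le> t * r"
      using elim(3) by (simp_all add: p_def q_def r_def h_def)
    show ?case
      using median_defect_sign[OF nonneg(1) h m(1,2) nonneg(2-4) sm m(4) R m(3)] .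
  qed
qed

text \<open>The limit of the comparison. Triangles with coinciding vertices are excluded from it; for them
  the parallelogram law is evident.\<close>

lemma norm_parallelogram_inequality:
  fixes x y :: "'a::real_normed_vector" and U :: "'a set"
  assumes comp: "triangle_comparison R K U" and U: "0 \<in> interior U"
    and R: "R = (\<le>) \<or> R = (\<ge>)"
  shows "R ((norm (x + y))\<^sup>2 + (norm (x - y))\<^sup>2) (2 * (norm x)\<^sup>2 + 2 * (norm y)\<^sup>2)"
proof (cases "x = 0 \<or> y = 0 \<or> x = y")
  case True
  have "norm (x + x) = 2 * norm x"
    by (metis norm_scaleR scaleR_2 abs_numeral)
  then show ?thesis
    using True R by (auto simp: power_mult_distrib)
next
  case False
  define L where "L = (norm (x + y) / 2)\<^sup>2 + (norm (x - y) / 2)\<^sup>2 - ((norm x)\<^sup>2 + (norm y)\<^sup>2) / 2"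
  let ?D = "\<lambda>t. median_defect K (t * norm x) (t * norm y) (t * norm (x - y)) (t * (norm (x + y) / 2)) / t\<^sup>2"
  have lim: "(?D \<longlongrightarrow> L) (at_right 0)"
    unfolding L_def by (rule median_defect_limit)
  have "\<forall>\<^sub>F t in at_right 0. R (?D t) 0"
  proof (rule eventually_mono)
    show "\<forall>\<^sub>F t in at_right 0.
        R (median_defect K (t * norm x) (t * norm y) (t * norm (x - y)) (t * (norm (x + y) / 2))) 0"
      using False by (intro eventually_median_comparison[OF comp U R]) auto
  qed (use R in \<open>auto simp: divide_nonpos_nonneg\<close>)
  then have "R L 0"
    using tendsto_upperbound[OF lim] tendsto_lowerbound[OF lim] R by auto
  then show ?thesis
    using R by (auto simp: L_def power_divide)
qed

theorem lemma1p1: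
  assumes "\<not> norm_from_inner_product TYPE('a::real_normed_vector)"
  shows "(\<nexists>K. sectional_curvature_bounded_below TYPE('a) K) \<and>
         (\<nexists>K. sectional_curvature_bounded_above TYPE('a) K)"
proof -
  have "\<not> triangle_comparison R K U"
    if "0 \<in> interior U" "R = (\<le>) \<or> R = (\<ge>)" for R K and U :: "'a set"
    using jordan_von_neumann[where 'a = 'a] assms that parallelogram_law_of_inequality[where R = R]
      norm_parallelogram_inequality[of R K U] by blast
  then show ?thesis
    unfolding sectional_curvature_bounded_below_def sectional_curvature_bounded_above_def by blast
qed

end
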